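(* Let $X$ be an $\aleph_0$-space and $Y$ a topological space. Then: (1) If $Y$ is a $\mathfrak{P}$-space, then the function space $C_c(X,Y)$ has the strong Pytkeev property. (2) If $Y$ is a strict $\aleph$-space, then the function space $C_c(X,Y)$ has a countable $ck$-network at each function $f\in C_c(X,Y)$.
   Context: All topological spaces are Hausdorff. $C_c(X,Y)$ is the set $C(X,Y)$ of all continuous functions from $X$ to $Y$ with the compact-open topology, i.e. the topology with subbase consisting of the sets $\{f\in C(X,Y): f(K)\subseteq U\}$ with $K\subseteq X$ compact and $U\subseteq Y$ open. Let $\mathcal N$ be a family of subsets of a space $X$. $\mathcal N$ is a $k$-network in $X$ if whenever $K\subset U$ with $K$ compact and $U$ open in $X$, then $K\subset\bigcup\mathcal F\subset U$ for some finite $\mathcal F\subset\mathcal N$. $\mathcal N$ is a $ck$-network at $x\in X$ if for any neighborhood $O_x$ of $x$ there is a neighborhood $U_x$ of $x$ such that for each compact subset $K\subset U_x$ there is a finite subfamily $\mathcal F\subset\mathcal N$ with $x\in\bigcap\mathcal F$ and $K\subset\bigcup\mathcal F\subset O_x$. $\mathcal N$ is a $cp$-network at $x$ if either $x$ is isolated in $X$ and $\{x\}\in\mathcal N$, or for each $A\subset X$ with $x\in\overline A\setminus A$ and each neighborhood $O_x$ of $x$ there is $N\in\mathcal N$ such that $x\in N\subset O_x$ and $N\cap A$ is infinite. $\mathcal N$ is a $ck$-network (resp. $cp$-network) in $X$ if it is one at each point of $X$. A family is $\sigma$-locally finite if it is a countable union of locally finite families. An $\aleph_0$-space is a regular space with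 a countable $k$-network. A $\mathfrak{P}$-space is a regular space with a $\sigma$-locally finite $cp$-network. A strict $\aleph$-space is a regular space with a $\sigma$-locally finite $ck$-network. A space $X$ has the strong Pytkeev property if for each $x\in X$ there is a countable family $\mathcal D$ of subsets of $X$ such that for each neighborhood $U$ of $x$ and each $A\subseteq X$ with $x\in\overline A\setminus A$ there is $D\in\mathcal D$ such that $D\subseteq U$ and $D\cap A$ is infinite. *)

theory Defs
  imports "HOL-Analysis.Analysis"
begin

text \<open>Spaces are objects of type \<^typ>\<open>'a topology\<close>, and all points and sets are relativised to
  \<^const>\<open>topspace\<close>. Since \<^const>\<open>regular_space\<close> does not include any separation of points, the
  standing convention that all spaces are Hausdorff is made explicit in the definitions of the
  classes of spaces below.\<close>

definition neighborhood_in :: "'a topology \<Rightarrow> 'a \<Rightarrow> 'a set \<Rightarrow> bool" where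
  "neighborhood_in X x V \<longleftrightarrow> V \<subseteq> topspace X \<and> (\<exists>U. openin X U \<and> x \<in> U \<and> U \<subseteq> V)"

definition k_network :: "'a topology \<Rightarrow> 'a set set \<Rightarrow> bool" where
  "k_network X \<N> \<longleftrightarrow>
     \<N> \<subseteq> Pow (topspace X) \<and>
     (\<forall>K U. compactin X K \<and> openin X U \<and> K \<subseteq> U \<longrightarrow>
        (\<exists>\<F>. finite \<F> \<and> \<F> \<subseteq> \<N> \<and> K \<subseteq> \<Union>\<F> \<and> \<Union>\<F> \<subseteq> U))"

text \<open>For empty \<open>\<F>\<close> (possible only for \<open>K = {}\<close>) the condition \<open>x \<in> \<Inter>\<F>\<close> holds, as \<open>\<Inter>{} = UNIV\<close>.
  The convention does not matter: a family \<open>\<F>\<close> for \<open>K = {x}\<close> is nonempty and serves \<open>K = {}\<close> too.\<close>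

definition ck_network_at :: "'a topology \<Rightarrow> 'a \<Rightarrow> 'a set set \<Rightarrow> bool" where
  "ck_network_at X x \<N> \<longleftrightarrow>
     \<N> \<subseteq> Pow (topspace X) \<and>
     (\<forall>V. neighborhood_in X x V \<longrightarrow>
        (\<exists>U. neighborhood_in X x U \<and>
           (\<forall>K. compactin X K \<and> K \<subseteq> U \<longrightarrow>
              (\<exists>\<F>. finite \<F> \<and> \<F> \<subseteq> \<N> \<and> x \<in> \<Inter>\<F> \<and> K \<subseteq> \<Union>\<F> \<and> \<Union>\<F> \<subseteq> V))))"

definition ck_network :: "'a topology \<Rightarrow> 'a set set \<Rightarrow> bool" where
  "ck_network X \<N> \<longleftrightarrow> \<N> \<subseteq> Pow (topspace X) \<and> (\<forall>x\<in>topspace X. ck_network_at X x \<N>)"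

text \<open>The alternative for isolated points is the usual plain disjunction. At an isolated point the
  second disjunct is vacuously true, so this is the weakest reading of the notion; a family that
  contains the singletons of all isolated points satisfies it in particular.\<close>

definition cp_network_at :: "'a topology \<Rightarrow> 'a \<Rightarrow> 'a set set \<Rightarrow> bool" where
  "cp_network_at X x \<N> \<longleftrightarrow>
     \<N> \<subseteq> Pow (topspace X) \<and>
     ((openin X {x} \<and> {x} \<in> \<N>) \<or>
      (\<forall>A V. A \<subseteq> topspace X \<and> x \<in> X closure_of A - A \<and> neighborhood_in X x V \<longrightarrow>
         (\<exists>N\<in>\<N>. x \<in> N \<and> N \<subseteq> V \<and> infinite (N \<inter> A))))"

definition cp_network :: "'a topology \<Rightarrow> 'a set set \<Rightarrow> bool" where
  "cp_network X \<N> \<longleftrightarrow> \<N> \<subseteq> Pow (topspace X) \<and> (\<forall>x\<in>topspace X. cp_network_at X x \<N>)"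

definition sigma_locally_finite_in :: "'a topology \<Rightarrow> 'a set set \<Rightarrow> bool" where
  "sigma_locally_finite_in X \<N> \<longleftrightarrow>
     (\<exists>\<F> :: nat \<Rightarrow> 'a set set. (\<forall>n. locally_finite_in X (\<F> n)) \<and> \<N> = (\<Union>n. \<F> n))"

definition aleph0_space :: "'a topology \<Rightarrow> bool" where
  "aleph0_space X \<longleftrightarrow>
     Hausdorff_space X \<and> regular_space X \<and> (\<exists>\<N>. countable \<N> \<and> k_network X \<N>)"

definition frakP_space :: "'a topology \<Rightarrow> bool" where
  "frakP_space X \<longleftrightarrow>
     Hausdorff_space X \<and> regular_space X \<and>
     (\<exists>\<N>. sigma_locally_finite_in X \<N> \<and> cp_network X \<N>)"

definition strict_aleph_space :: "'a topology \<Rightarrow> bool" where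
  "strict_aleph_space X \<longleftrightarrow>
     Hausdorff_space X \<and> regular_space X \<and>
     (\<exists>\<N>. sigma_locally_finite_in X \<N> \<and> ck_network X \<N>)"

definition strong_Pytkeev_property :: "'a topology \<Rightarrow> bool" where
  "strong_Pytkeev_property X \<longleftrightarrow>
     (\<forall>x\<in>topspace X. \<exists>\<D>. countable \<D> \<and> \<D> \<subseteq> Pow (topspace X) \<and>
        (\<forall>U A. neighborhood_in X x U \<and> A \<subseteq> topspace X \<and> x \<in> X closure_of A - A \<longrightarrow>
           (\<exists>D\<in>\<D>. D \<subseteq> U \<and> infinite (D \<inter> A))))"

text \<open>A continuous map from \<open>X\<close> to \<open>Y\<close> is represented by the unique HOL function that is
  \<^const>\<open>undefined\<close> outside \<^term>\<open>topspace X\<close>, as for \<^const>\<open>product_topology\<close>.\<close>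

definition continuous_maps :: "'a topology \<Rightarrow> 'b topology \<Rightarrow> ('a \<Rightarrow> 'b) set" where
  "continuous_maps X Y = {f \<in> extensional (topspace X). continuous_map X Y f}"

definition compact_open_topology :: "'a topology \<Rightarrow> 'b topology \<Rightarrow> ('a \<Rightarrow> 'b) topology" where
  "compact_open_topology X Y =
     topology_generated_by
       {{f \<in> continuous_maps X Y. f ` K \<subseteq> U} | K U. compactin X K \<and> openin Y U}"

lemma topspace_compact_open_topology [simp]:
  "topspace (compact_open_topology X Y) = continuous_maps X Y"
proof -
  have "continuous_maps X Y = {f \<in> continuous_maps X Y. f ` {} \<subseteq> {}}"
    by simp
  then have "continuous_maps X Y
      \<in> {{f \<in> continuous_maps X Y. f ` K \<subseteq> U} | K U. compactin X K \<and> openin Y U}"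
    using compactin_empty openin_empty by blast
  then show ?thesis
    unfolding compact_open_topology_def topology_generated_by_topspace by blast
qed

end

theory Submission
  imports Defs
begin

text \<open>Fix \<open>f\<close>. Since \<open>f ` X\<close> has a countable network, only countably many members of a
  \<open>\<sigma>\<close>-locally finite family meet it; enumerate them as \<open>N\<^sub>0, N\<^sub>1, \<dots>\<close>. For compact \<open>K\<close> and open
  \<open>U \<supseteq> f ` K\<close>, let \<open>L\<^sub>n\<close> be the intersection of the first \<open>n\<close> members of a countable \<open>k\<close>-network
  (closed under finite unions) that contain \<open>K\<close>, and \<open>E\<^sub>n\<close> the union of those of the first \<open>n\<close> sets
  \<open>N\<^sub>j\<close> that lie in \<open>U\<close>. The countable family consists of the finite intersections of the sets
  \<open>[L\<^sub>n; E\<^sub>n]\<close> of maps sending \<open>L\<^sub>n\<close> into \<open>E\<^sub>n\<close>. As \<open>L\<^sub>n\<close> shrinks to \<open>K\<close>, adding to \<open>K\<close> points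
  \<open>x\<^sub>n \<in> L\<^sub>n\<close> keeps it compact.

  For (1), suppose that \<open>A\<close> accumulates at \<open>f\<close> but meets each \<open>[L\<^sub>n; E\<^sub>n]\<close> in a finite set. A map
  \<open>b \<in> A\<close> lying in none of them sends a point of \<open>K\<close> to a cluster point of a sequence
  \<open>y\<^sub>n \<notin> E\<^sub>n\<close>; the closure of the set \<open>P\<close> of all such cluster points misses \<open>f ` K\<close>, so
  \<open>[K; Y - cl P]\<close> separates \<open>f\<close> from these maps. The remaining maps form a countable set; each has a
  witness \<open>x\<^sub>c \<in> L\<^sub>n\<close> with \<open>c x\<^sub>c \<notin> E\<^sub>n\<close>, only finitely many of them for each \<open>n\<close>, and
  \<open>K \<union> {x\<^sub>c}\<close> is compact, which again yields a neighborhood of \<open>f\<close> missing almost all of them.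

  For (2), the \<open>ck\<close>-property gives an open \<open>G \<supseteq> f ` K\<close> such that each compact subset of \<open>G\<close> lies in
  some \<open>E\<^sub>n\<close>. By continuity of the evaluation on compact sets, each compact subset of \<open>[K; G]\<close> lies
  in some \<open>[L\<^sub>n; E\<^sub>n]\<close>.\<close>

section \<open>The compact-open topology\<close>

text \<open>Neither \<open>K\<close> compact nor \<open>U\<close> open is required, so the same
  notation covers both the subbasic open sets and the sets \<open>maps_into X Y (L n) (E n)\<close>
  of the countable family.\<close>

definition maps_into :: "'a topology \<Rightarrow> 'b topology \<Rightarrow> 'a set \<Rightarrow> 'b set \<Rightarrow> ('a \<Rightarrow> 'b) set" where
  "maps_into X Y K U = {f \<in> continuous_maps X Y. f ` K \<subseteq> U}"

lemma maps_into_mono: "K' \<subseteq> K \<Longrightarrow> U \<subseteq> U' \<Longrightarrow> maps_into X Y K U \<subseteq> maps_into X Y K' U'"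
  unfolding maps_into_def by (auto simp: image_subset_iff subset_eq)

lemma openin_maps_into:
  assumes "compactin X K" "openin Y U"
  shows "openin (compact_open_topology X Y) (maps_into X Y K U)"
  unfolding compact_open_topology_def maps_into_def
  by (rule topology_generated_by_Basis) (use assms in blast)

text \<open>Basic neighborhoods are coded by finite sets of pairs, so that approximations can later
  be attached to each pair separately. The conjunct \<open>g \<in> continuous_maps X Y\<close> keeps
  the intersection inside the space when \<open>I\<close> is empty.\<close>

lemma openin_compact_open_topologyE:
  assumes "openin (compact_open_topology X Y) W" "f \<in> W"
  obtains I where "finite I"
    "\<And>i. i \<in> I \<Longrightarrow> compactin X (fst i) \<and> openin Y (snd i) \<and> f \<in> maps_into X Y (fst i) (snd i)"
    "{g \<in> continuous_maps X Y. \<forall>i \<in> I. g \<in> maps_into X Y (fst i) (snd i)} \<subseteq> W"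
proof -
  have "generate_topology_on {{f \<in> continuous_maps X Y. f ` K \<subseteq> U} | K U. compactin X K \<and> openin Y U} W"
    using assms(1) unfolding compact_open_topology_def by (simp add: openin_topology_generated_by)
  then have "f \<in> W \<longrightarrow> (\<exists>I. finite I \<and>
      (\<forall>i \<in> I. compactin X (fst i) \<and> openin Y (snd i) \<and> f \<in> maps_into X Y (fst i) (snd i)) \<and>
      {g \<in> continuous_maps X Y. \<forall>i \<in> I. g \<in> maps_into X Y (fst i) (snd i)} \<subseteq> W)"
  proof (induction rule: generate_topology_on.induct)
    case Empty
    then show ?case by simp
  next
    case (Int a b)
    show ?case
    proof
      assume "f \<in> a \<inter> b"
      then obtain I J where "finite I" "finite J"
        "\<forall>i \<in> I. compactin X (fst i) \<and> openin Y (snd i) \<and> f \<in> maps_into X Y (fst i) (snd i)"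
        "\<forall>i \<in> J. compactin X (fst i) \<and> openin Y (snd i) \<and> f \<in> maps_into X Y (fst i) (snd i)"
        "{g \<in> continuous_maps X Y. \<forall>i \<in> I. g \<in> maps_into X Y (fst i) (snd i)} \<subseteq> a"
        "{g \<in> continuous_maps X Y. \<forall>i \<in> J. g \<in> maps_into X Y (fst i) (snd i)} \<subseteq> b"
        using Int.IH by blast
      then show "\<exists>I. finite I \<and>
          (\<forall>i \<in> I. compactin X (fst i) \<and> openin Y (snd i) \<and> f \<in> maps_into X Y (fst i) (snd i)) \<and>
          {g \<in> continuous_maps X Y. \<forall>i \<in> I. g \<in> maps_into X Y (fst i) (snd i)} \<subseteq> a \<inter> b"
        by (intro exI[of _ "I \<union> J"]) auto
    qed
  next
    case (UN k)
    show ?case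
    proof
      assume "f \<in> \<Union> k"
      then obtain w where "w \<in> k" "f \<in> w" by blast
      with UN.IH[of w] obtain I where "finite I"
          "\<forall>i \<in> I. compactin X (fst i) \<and> openin Y (snd i) \<and> f \<in> maps_into X Y (fst i) (snd i)"
          "{g \<in> continuous_maps X Y. \<forall>i \<in> I. g \<in> maps_into X Y (fst i) (snd i)} \<subseteq> w"
        by blast
      with \<open>w \<in> k\<close> show "\<exists>I. finite I \<and>
          (\<forall>i \<in> I. compactin X (fst i) \<and> openin Y (snd i) \<and> f \<in> maps_into X Y (fst i) (snd i)) \<and>
          {g \<in> continuous_maps X Y. \<forall>i \<in> I. g \<in> maps_into X Y (fst i) (snd i)} \<subseteq> \<Union> k"
        by (intro exI[of _ I]) blast
    qed
  next
    case (Basis s)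
    then obtain K U where "compactin X K" "openin Y U" "s = maps_into X Y K U"
      unfolding maps_into_def by blast
    then show ?case
      by (intro impI exI[of _ "{(K, U)}"]) auto
  qed
  with assms(2) that show thesis by blast
qed

text \<open>Serves to discard finite sets of maps, which are closed. Extensionality places the point
  where two distinct maps differ inside \<open>topspace X\<close>.\<close>

lemma t1_space_compact_open_topology:
  assumes "t1_space Y"
  shows "t1_space (compact_open_topology X Y)"
  unfolding t1_space_def topspace_compact_open_topology
proof (intro ballI impI)
  fix f g
  assume fg: "f \<in> continuous_maps X Y" "g \<in> continuous_maps X Y" "f \<noteq> g"
  then obtain x where x: "x \<in> topspace X" "f x \<noteq> g x"
    unfolding continuous_maps_def by (metis (no_types, lifting) extensionalityI mem_Collect_eq)
  have fx: "f x \<in> topspace Y" and gx: "g x \<in> topspace Y"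
    using fg x unfolding continuous_maps_def continuous_map_def by auto
  obtain U where "openin Y U" "f x \<in> U" "g x \<notin> U"
    using assms fx gx x(2) unfolding t1_space_def by blast
  with fg(1) x(1) show "\<exists>U. openin (compact_open_topology X Y) U \<and> f \<in> U \<and> g \<notin> U"
    by (intro exI[of _ "maps_into X Y {x} U"] conjI openin_maps_into)
      (auto simp: maps_into_def)
qed

lemma continuous_map_evaluation_on_compact:
  assumes "Hausdorff_space X" "compactin X K"
  shows "continuous_map (prod_topology (compact_open_topology X Y) (subtopology X K)) Y (\<lambda>(c, x). c x)"
proof -
  let ?P = "prod_topology (compact_open_topology X Y) (subtopology X K)"
  let ?S = "subtopology X K"
  have K: "K \<subseteq> topspace X" "topspace ?S = K"
    using assms(2) compactin_subset_topspace by fastforce+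
  have cs: "compact_space ?S"
    using assms(2) by (simp add: compact_space_subtopology)
  have "regular_space ?S"
    by (simp add: assms(1) cs Hausdorff_space_subtopology compact_Hausdorff_imp_regular_space)
  then have nb: "neighbourhood_base_of (closedin ?S) ?S"
    by (simp add: neighbourhood_base_of_closedin)
  have "openin ?P {p \<in> topspace ?P. (\<lambda>(c, x). c x) p \<in> W}" if W: "openin Y W" for W
  proof (subst openin_subopen, clarify)
    fix c x
    assume "(c, x) \<in> topspace ?P" "c x \<in> W"
    then have c: "c \<in> continuous_maps X Y" and x: "x \<in> K" "c x \<in> W"
      by (auto simp: K)
    have "continuous_map ?S Y c"
      using c continuous_map_from_subtopology unfolding continuous_maps_def by blast
    then have "openin ?S {z \<in> K. c z \<in> W}"
      using W K(2) openin_continuous_map_preimage by fastforce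
    then obtain V F where VF: "openin ?S V" "closedin ?S F" "x \<in> V" "V \<subseteq> F" "F \<subseteq> {z \<in> K. c z \<in> W}"
      using nb x unfolding neighbourhood_base_of by (metis (mono_tags, lifting) mem_Collect_eq)
    have "compactin X F"
      using closedin_compact_space[OF cs VF(2)] by (simp add: compactin_subtopology)
    then have "openin ?P (maps_into X Y F W \<times> V)"
      using VF(1) W by (simp add: openin_prod_Times_iff openin_maps_into)
    moreover have "(c, x) \<in> maps_into X Y F W \<times> V"
      using c VF by (auto simp: maps_into_def)
    moreover have "maps_into X Y F W \<times> V \<subseteq> {p \<in> topspace ?P. (\<lambda>(c, x). c x) p \<in> W}"
    proof clarify
      fix c' x'
      assume "c' \<in> maps_into X Y F W" "x' \<in> V"
      moreover from this have "x' \<in> F" "x' \<in> K" using VF by blast+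
      ultimately show "(c', x') \<in> topspace ?P \<and> c' x' \<in> W"
        unfolding maps_into_def using K by auto
    qed
    ultimately show "\<exists>T. openin ?P T \<and> (c, x) \<in> T \<and> T \<subseteq> {p \<in> topspace ?P. (\<lambda>(c, x). c x) p \<in> W}"
      by blast
  qed
  moreover have "(\<lambda>(c, x). c x) \<in> topspace ?P \<rightarrow> topspace Y"
    using K by (auto simp: continuous_maps_def continuous_map_def)
  ultimately show ?thesis
    unfolding continuous_map_def by blast
qed

lemma compactin_finite_subcover_image:
  assumes "compactin X K" "\<And>i. i \<in> J \<Longrightarrow> openin X (V i)" "K \<subseteq> (\<Union>i\<in>J. V i)"
  obtains T where "finite T" "T \<subseteq> J" "K \<subseteq> (\<Union>i\<in>T. V i)"
proof -
  have "Ball (V ` J) (openin X) \<and> K \<subseteq> \<Union> (V ` J)" using assms(2,3) by blast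
  then obtain \<F> where "finite \<F>" "\<F> \<subseteq> V ` J" "K \<subseteq> \<Union> \<F>"
    using assms(1) unfolding compactin_def by meson
  then show thesis using that by (metis finite_subset_image)
qed

section \<open>Sequences of sets shrinking to a compact set\<close>

text \<open>The sets \<open>L n\<close> need be neither open nor closed: they will be intersections
  of members of a network.\<close>

definition shrinks_to :: "'a topology \<Rightarrow> (nat \<Rightarrow> 'a set) \<Rightarrow> 'a set \<Rightarrow> bool" where
  "shrinks_to X L K \<longleftrightarrow> decseq L \<and> (\<forall>n. K \<subseteq> L n \<and> L n \<subseteq> topspace X) \<and>
     (\<forall>U. openin X U \<and> K \<subseteq> U \<longrightarrow> (\<exists>n. L n \<subseteq> U))"

lemma shrinks_toD:
  assumes "shrinks_to X L K"
  shows "m \<le> n \<Longrightarrow> L n \<subseteq> L m" "K \<subseteq> L n" "L n \<subseteq> topspace X"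
    "openin X U \<Longrightarrow> K \<subseteq> U \<Longrightarrow> \<exists>n. L n \<subseteq> U"
  using assms by (auto simp: shrinks_to_def decseq_def)

text \<open>The union of a finite subcover of \<open>K\<close> already contains some
  \<open>L n\<close>, hence every \<open>x c\<close> with \<open>n \<le> \<nu> c\<close>; finitely
  many points remain. A level function \<open>\<nu>\<close> replaces a sequence because several
  indices may share a level.\<close>

lemma compactin_Un_shrinking:
  assumes L: "shrinks_to X L K" and K: "compactin X K"
    and x: "\<And>c. c \<in> C \<Longrightarrow> x c \<in> L (\<nu> c)" and fin: "\<And>n. finite {c \<in> C. \<nu> c < n}"
  shows "compactin X (K \<union> x ` C)"
  unfolding compactin_def
proof (intro conjI allI impI)
  show "K \<union> x ` C \<subseteq> topspace X"
    using x shrinks_toD(3)[OF L] compactin_subset_topspace[OF K] by blast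
next
  fix \<U>
  assume \<U>: "Ball \<U> (openin X) \<and> K \<union> x ` C \<subseteq> \<Union> \<U>"
  then obtain \<F> where \<F>: "finite \<F>" "\<F> \<subseteq> \<U>" "K \<subseteq> \<Union> \<F>"
    using K unfolding compactin_def by (meson le_sup_iff)
  have "openin X (\<Union> \<F>)" using \<U> \<F> by blast
  then obtain n where n: "L n \<subseteq> \<Union> \<F>" using \<F>(3) shrinks_toD(4)[OF L] by blast
  have "\<forall>c \<in> C. \<exists>U \<in> \<U>. x c \<in> U" using \<U> by blast
  then obtain u where u: "\<And>c. c \<in> C \<Longrightarrow> u c \<in> \<U> \<and> x c \<in> u c" by metis
  have "x c \<in> \<Union> (\<F> \<union> u ` {c \<in> C. \<nu> c < n})" if "c \<in> C" for c
  proof (cases "\<nu> c < n")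
    case True
    then show ?thesis using u that by blast
  next
    case False
    then have "L (\<nu> c) \<subseteq> L n" by (intro shrinks_toD(1)[OF L]) auto
    then show ?thesis using x[OF that] n by blast
  qed
  then have "K \<union> x ` C \<subseteq> \<Union> (\<F> \<union> u ` {c \<in> C. \<nu> c < n})"
    using \<F>(3) by blast
  moreover have "finite (\<F> \<union> u ` {c \<in> C. \<nu> c < n})" "\<F> \<union> u ` {c \<in> C. \<nu> c < n} \<subseteq> \<U>"
    using \<F> u fin by auto
  ultimately show "\<exists>\<F>. finite \<F> \<and> \<F> \<subseteq> \<U> \<and> K \<union> x ` C \<subseteq> \<Union> \<F>"
    by blast
qed

definition cluster_point :: "'a topology \<Rightarrow> (nat \<Rightarrow> 'a) \<Rightarrow> 'a \<Rightarrow> bool" where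
  "cluster_point X x z \<longleftrightarrow> z \<in> topspace X \<and> (\<forall>V m. openin X V \<and> z \<in> V \<longrightarrow> (\<exists>n\<ge>m. x n \<in> V))"

lemma cluster_point_continuous_map:
  assumes "continuous_map X Y f" "cluster_point X x z" "\<And>n. x n \<in> topspace X"
  shows "cluster_point Y (\<lambda>n. f (x n)) (f z)"
  unfolding cluster_point_def
proof (intro conjI allI impI)
  show "f z \<in> topspace Y"
    using assms by (auto simp: cluster_point_def continuous_map_def)
  fix V m
  assume V: "openin Y V \<and> f z \<in> V"
  have "openin X {x \<in> topspace X. f x \<in> V}"
    using assms(1) V openin_continuous_map_preimage by blast
  then show "\<exists>n\<ge>m. f (x n) \<in> V"
    using assms(2) V unfolding cluster_point_def by (metis (mono_tags, lifting) mem_Collect_eq)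
qed

text \<open>Otherwise finitely many open sets, each missed by a tail of \<open>x\<close>, cover
  \<open>K\<close> and therefore some \<open>L n\<close>, which contains all late terms of
  \<open>x\<close>.\<close>

lemma shrinking_cluster_point:
  assumes L: "shrinks_to X L K" and K: "compactin X K" and x: "\<And>n. x n \<in> L n"
  obtains z where "z \<in> K" "cluster_point X x z"
proof (rule ccontr)
  assume "\<not> thesis"
  then have "\<not> cluster_point X x z" if "z \<in> K" for z
    using that \<open>\<And>z. z \<in> K \<Longrightarrow> cluster_point X x z \<Longrightarrow> thesis\<close> by blast
  moreover have "z \<in> topspace X" if "z \<in> K" for z
    using that compactin_subset_topspace[OF K] by blast
  ultimately have "\<forall>z \<in> K. \<exists>V m. openin X V \<and> z \<in> V \<and> (\<forall>n\<ge>m. x n \<notin> V)"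
    unfolding cluster_point_def by meson
  then obtain V m where V: "\<And>z. z \<in> K \<Longrightarrow> openin X (V z) \<and> z \<in> V z \<and> (\<forall>n\<ge>m z. x n \<notin> V z)"
    by metis
  obtain T where T: "finite T" "T \<subseteq> K" "K \<subseteq> (\<Union>z\<in>T. V z)"
    using compactin_finite_subcover_image[OF K, of K V] V by blast
  have "openin X (\<Union>z\<in>T. V z)" using V T by blast
  then obtain n where n: "L n \<subseteq> (\<Union>z\<in>T. V z)"
    using T(3) shrinks_toD(4)[OF L] by blast
  define k where "k = Max (insert n (m ` T))"
  have k: "n \<le> k" "\<And>z. z \<in> T \<Longrightarrow> m z \<le> k"
    using T(1) by (auto simp: k_def)
  have "x k \<in> L n" using x shrinks_toD(1)[OF L k(1)] by blast
  then show False using n V T k(2) by blast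
qed

section \<open>Capturing sequences\<close>

text \<open>The first conjunct is stated separately because the second is vacuous at an isolated
  point \<open>y\<close>.\<close>

definition captures_at :: "'a topology \<Rightarrow> (nat \<Rightarrow> 'a set) \<Rightarrow> 'a \<Rightarrow> bool" where
  "captures_at Y E y \<longleftrightarrow> (\<exists>n. y \<in> E n) \<and>
     (\<forall>A. A \<subseteq> topspace Y \<and> y \<in> Y closure_of A - A \<longrightarrow> (\<exists>n. infinite (E n \<inter> A)))"

definition countably_tight_at :: "'a topology \<Rightarrow> 'a \<Rightarrow> bool" where
  "countably_tight_at Y y \<longleftrightarrow>
     (\<forall>A. A \<subseteq> topspace Y \<and> y \<in> Y closure_of A \<longrightarrow>
        (\<exists>B. countable B \<and> B \<subseteq> A \<and> y \<in> Y closure_of B))"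

text \<open>Take \<open>j\<close> with \<open>y \<in> E j\<close>. From level \<open>j\<close> on,
  no \<open>q c\<close> equals \<open>y\<close>, and since \<open>E\<close> increases,
  \<open>E n\<close> contains \<open>q c\<close> only if \<open>\<nu> c < n\<close>. So each
  \<open>E n\<close> meets this set of values in a finite set, and \<open>y\<close> cannot be in its
  closure.\<close>

lemma captures_at_not_in_closure:
  assumes E: "captures_at Y E y" "incseq E"
    and q: "\<And>c. c \<in> C \<Longrightarrow> q c \<in> topspace Y - E (\<nu> c)" and fin: "\<And>n. finite {c \<in> C. \<nu> c < n}"
  obtains j where "y \<notin> Y closure_of (q ` {c \<in> C. j \<le> \<nu> c})"
proof -
  obtain j where j: "y \<in> E j" using E unfolding captures_at_def by blast
  let ?A = "q ` {c \<in> C. j \<le> \<nu> c}"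
  have "y \<notin> ?A" using q j E(2) unfolding incseq_def by blast
  moreover have "finite (E n \<inter> ?A)" for n
  proof (rule finite_subset)
    show "E n \<inter> ?A \<subseteq> q ` {c \<in> C. \<nu> c < n}"
      using q E(2) unfolding incseq_def by (smt (verit) DiffE IntE imageE image_eqI linorder_not_less mem_Collect_eq subset_iff)
  qed (use fin in blast)
  moreover have "?A \<subseteq> topspace Y" using q by blast
  ultimately have "y \<notin> Y closure_of ?A"
    using E(1) unfolding captures_at_def by blast
  then show thesis using that by blast
qed

text \<open>Countable tightness reduces the cluster points to a sequence \<open>p\<close>, and each
  \<open>p m\<close> comes with a sequence \<open>q m\<close>. If \<open>y\<close> were in the
  closure, it would be in the closure of every tail of the array formed by these sequences, against
  the previous lemma.\<close>

lemma captures_at_not_in_closure_cluster_points: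
  assumes E: "captures_at Y E y" "incseq E" and tight: "countably_tight_at Y y"
  shows "y \<notin> Y closure_of {p. \<exists>q. (\<forall>k. q k \<in> topspace Y - E k) \<and> cluster_point Y q p}"
    (is "_ \<notin> Y closure_of ?P")
proof
  assume "y \<in> Y closure_of ?P"
  moreover have "?P \<subseteq> topspace Y" unfolding cluster_point_def by blast
  ultimately obtain B where B: "countable B" "B \<subseteq> ?P" "y \<in> Y closure_of B"
    using tight unfolding countably_tight_at_def by meson
  then have "B \<noteq> {}" by auto
  then obtain p :: "nat \<Rightarrow> 'a" where p: "range p = B"
    using range_from_nat_into[OF _ B(1)] by blast
  then have "\<forall>m::nat. \<exists>q. (\<forall>k. q k \<in> topspace Y - E k) \<and> cluster_point Y q (p m)"
    using B(2) by blast
  then obtain q where q: "\<And>m k. q m k \<in> topspace Y - E k" "\<And>m. cluster_point Y (q m) (p m)"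
    by metis
  \<comment> \<open>The triangle contains a tail of every row \<open>q m\<close> but only finitely
    many entries with second index below a given \<open>n\<close>, as the finiteness hypothesis
    demands.\<close>
  let ?C = "{(m, k). m \<le> k} :: (nat \<times> nat) set"
  have fin: "finite {c \<in> ?C. snd c < n}" for n
    by (rule finite_subset[of _ "{..n} \<times> {..n}"]) auto
  have "case_prod q c \<in> topspace Y - E (snd c)" for c using q(1) by (cases c) simp
  then obtain j where "y \<notin> Y closure_of (case_prod q ` {c \<in> ?C. j \<le> snd c})"
    using captures_at_not_in_closure[OF E _ fin] by blast
  moreover have "y \<in> Y closure_of (case_prod q ` {c \<in> ?C. j \<le> snd c})"
    unfolding in_closure_of
  proof (intro conjI allI impI)
    show "y \<in> topspace Y" using B(3) in_closure_of by fast
    fix V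
    assume V: "y \<in> V \<and> openin Y V"
    then obtain m where "p m \<in> V"
      using B(3) p unfolding in_closure_of by blast
    then obtain k where "k \<ge> max m j" "q m k \<in> V"
      using q(2) V unfolding cluster_point_def by blast
    then show "\<exists>z. z \<in> case_prod q ` {c \<in> ?C. j \<le> snd c} \<and> z \<in> V"
      by (intro exI[of _ "q m k"]) force
  qed
  ultimately show False by blast
qed

text \<open>The set of cluster points depends on \<open>E\<close> alone and not on the map
  \<open>b\<close>, so a single neighborhood of \<open>f\<close> excludes all these maps at once.
  Witnesses \<open>x n \<in> L n\<close> with \<open>b (x n) \<notin> E n\<close> cluster at some
  \<open>z \<in> K\<close>, and then \<open>b z\<close> is one of the cluster points.\<close>

lemma not_in_closure_never_mapped:
  assumes f: "f \<in> continuous_maps X Y" and K: "compactin X K" and L: "shrinks_to X L K"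
    and E: "incseq E" "\<And>y. y \<in> f ` K \<Longrightarrow> captures_at Y E y \<and> countably_tight_at Y y"
  shows "f \<notin> compact_open_topology X Y closure_of
    {b \<in> continuous_maps X Y. \<forall>n. b \<notin> maps_into X Y (L n) (E n)}"
proof -
  let ?P = "{p. \<exists>q. (\<forall>k. q k \<in> topspace Y - E k) \<and> cluster_point Y q p}"
  let ?W = "maps_into X Y K (topspace Y - Y closure_of ?P)"
  have "f ` K \<subseteq> topspace Y"
    using f compactin_subset_topspace[OF K] unfolding continuous_maps_def continuous_map_def by blast
  then have "f \<in> ?W"
    using captures_at_not_in_closure_cluster_points E f unfolding maps_into_def by fastforce
  moreover have "openin (compact_open_topology X Y) ?W"
    using K by (intro openin_maps_into) auto
  moreover have "b \<notin> ?W" if b: "b \<in> continuous_maps X Y" "\<forall>n. b \<notin> maps_into X Y (L n) (E n)" for b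
  proof -
    have "\<forall>n. \<exists>x \<in> L n. b x \<notin> E n" using b unfolding maps_into_def by blast
    then obtain x where x: "\<And>n. x n \<in> L n" "\<And>n. b (x n) \<notin> E n" by metis
    have xt: "x n \<in> topspace X" for n using x(1) shrinks_toD(3)[OF L] by blast
    have bc: "continuous_map X Y b" using b unfolding continuous_maps_def by blast
    obtain z where z: "z \<in> K" "cluster_point X x z"
      using shrinking_cluster_point[OF L K] x(1) by blast
    have "cluster_point Y (\<lambda>n. b (x n)) (b z)"
      using cluster_point_continuous_map[OF bc z(2)] xt by blast
    moreover have "b (x n) \<in> topspace Y" for n
      using bc xt unfolding continuous_map_def by blast
    ultimately have "b z \<in> ?P"
      using x(2) by (intro CollectI exI[of _ "\<lambda>n. b (x n)"]) simp
    moreover have "?P \<subseteq> topspace Y" unfolding cluster_point_def by blast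
    ultimately have "b z \<in> Y closure_of ?P" using closure_of_subset by blast
    then show ?thesis using z(1) unfolding maps_into_def by blast
  qed
  ultimately show ?thesis unfolding in_closure_of by blast
qed

text \<open>Each \<open>c\<close> has a witness \<open>x c\<close> of its failure at level
  \<open>\<nu> c\<close>. Compactness of \<open>f\<close>
  K\<open>gives one level from which on the values\<close>c (x c)\<open>stay away from\<close>f
  \<open>K\<close>. Adding the late witnesses to \<open>K\<close> gives a compact set on which
  \<open>f\<close> avoids the closure of these values while every late \<open>c\<close> attains one
  of them. The remaining finitely many maps form a closed set without \<open>f\<close>.\<close>

lemma not_in_closure_finite_fibres:
  assumes t1: "t1_space Y"
    and f: "f \<in> continuous_maps X Y" and K: "compactin X K" and L: "shrinks_to X L K"
    and E: "incseq E" "\<And>y. y \<in> f ` K \<Longrightarrow> captures_at Y E y"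
    and C: "C \<subseteq> continuous_maps X Y" "f \<notin> C" "\<And>c. c \<in> C \<Longrightarrow> c \<notin> maps_into X Y (L (\<nu> c)) (E (\<nu> c))"
    and fin: "\<And>n. finite {c \<in> C. \<nu> c < n}"
  shows "f \<notin> compact_open_topology X Y closure_of C"
proof -
  let ?T = "compact_open_topology X Y"
  have fc: "continuous_map X Y f" using f unfolding continuous_maps_def by blast
  have "\<forall>c \<in> C. \<exists>x \<in> L (\<nu> c). c x \<notin> E (\<nu> c)" using C unfolding maps_into_def by blast
  then obtain x where x: "\<And>c. c \<in> C \<Longrightarrow> x c \<in> L (\<nu> c)" "\<And>c. c \<in> C \<Longrightarrow> c (x c) \<notin> E (\<nu> c)"
    by metis
  have q: "c (x c) \<in> topspace Y - E (\<nu> c)" if "c \<in> C" for c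
    using x[OF that] C(1) that shrinks_toD(3)[OF L]
    unfolding continuous_maps_def continuous_map_def by blast
  define Q where "Q j = (\<lambda>c. c (x c)) ` {c \<in> C. j \<le> \<nu> c}" for j
  define G where "G j = topspace Y - Y closure_of Q j" for j
  have Gmono: "G i \<subseteq> G j" if "i \<le> j" for i j
  proof -
    have "Q j \<subseteq> Q i" using that unfolding Q_def by auto
    then show ?thesis using closure_of_mono unfolding G_def by blast
  qed
  have fK: "compactin Y (f ` K)" using image_compactin[OF K fc] .
  have cover: "f ` K \<subseteq> (\<Union>j. G j)"
  proof
    fix y assume y: "y \<in> f ` K"
    obtain j where "y \<notin> Y closure_of Q j"
      using captures_at_not_in_closure[OF E(2)[OF y] E(1), of C "\<lambda>c. c (x c)" \<nu>] q fin
      unfolding Q_def by blast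
    then show "y \<in> (\<Union>j. G j)"
      using y compactin_subset_topspace[OF fK] unfolding G_def by blast
  qed
  have oG: "openin Y (G j)" for j unfolding G_def by auto
  obtain J where J: "finite J" "f ` K \<subseteq> (\<Union>j\<in>J. G j)"
    by (rule compactin_finite_subcover_image[OF fK _ cover]) (auto intro: oG that)
  define j where "j = Max (insert 0 J)"
  have "i \<le> j" if "i \<in> J" for i using that J(1) unfolding j_def by simp
  then have fG: "f ` K \<subseteq> G j" using J(2) Gmono by blast
  have "openin X {z \<in> topspace X. f z \<in> G j}"
    using openin_continuous_map_preimage[OF fc oG] .
  moreover have "K \<subseteq> {z \<in> topspace X. f z \<in> G j}"
    using fG compactin_subset_topspace[OF K] by blast
  ultimately obtain m where m: "L m \<subseteq> {z \<in> topspace X. f z \<in> G j}"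
    using shrinks_toD(4)[OF L] by blast
  \<comment> \<open>A level of at least \<open>j\<close> puts \<open>c (x c)\<close> into
    \<open>Q j\<close>; a level of at least \<open>m\<close> puts \<open>f (x c)\<close> into
    \<open>G j\<close>.\<close>
  define t where "t = max j m"
  let ?C' = "{c \<in> C. t \<le> \<nu> c}"
  let ?K' = "K \<union> x ` ?C'"
  let ?W = "maps_into X Y ?K' (G j)"
  have "compactin X ?K'"
  proof (rule compactin_Un_shrinking[OF L K])
    show "finite {c \<in> ?C'. \<nu> c < n}" for n by (rule finite_subset[OF _ fin[of n]]) auto
  qed (use x in blast)
  then have "openin ?T ?W" by (intro openin_maps_into) (auto simp: G_def)
  moreover have "f \<in> ?W"
  proof -
    have "f (x c) \<in> G j" if "c \<in> ?C'" for c
      using x(1)[of c] that m shrinks_toD(1)[OF L, of m "\<nu> c"] unfolding t_def by auto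
    then show ?thesis using fG f unfolding maps_into_def by blast
  qed
  moreover have "c \<notin> ?W" if c: "c \<in> ?C'" for c
  proof -
    have "Q j \<subseteq> topspace Y" using q unfolding Q_def by blast
    then have "Q j \<subseteq> Y closure_of Q j" by (rule closure_of_subset)
    moreover have "c (x c) \<in> Q j" using c unfolding Q_def t_def by auto
    ultimately show ?thesis using c unfolding G_def maps_into_def by blast
  qed
  ultimately have 1: "f \<notin> ?T closure_of ?C'" unfolding in_closure_of by blast
  have "{c \<in> C. \<nu> c < t} \<subseteq> topspace ?T" using C(1) by auto
  then have "closedin ?T {c \<in> C. \<nu> c < t}"
    using t1_space_compact_open_topology[OF t1, of X] fin[of t]
    unfolding t1_space_closedin_finite by blast
  then have 2: "f \<notin> ?T closure_of {c \<in> C. \<nu> c < t}"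
    using C(2) by (simp add: closure_of_closedin)
  have "C = ?C' \<union> {c \<in> C. \<nu> c < t}" by auto
  then have "?T closure_of C = ?T closure_of ?C' \<union> ?T closure_of {c \<in> C. \<nu> c < t}"
    by (metis closure_of_Un)
  with 1 2 show ?thesis by blast
qed

text \<open>If all intersections were finite, \<open>A\<close> would be covered by a finite set and,
  for each \<open>i \<in> I\<close>, the maps never entering the \<open>i\<close>-th sets
  (\<open>B i\<close>) and those failing coordinate \<open>i\<close> just before entering
  (\<open>C i\<close>). The two preceding lemmas keep \<open>f\<close> out of the closures of these
  finitely many parts.\<close>

lemma infinite_Int_maps_into:
  assumes t1: "t1_space Y" and f: "f \<in> continuous_maps X Y" and "finite I"
    and K: "\<And>i. i \<in> I \<Longrightarrow> compactin X (K i)" and L: "\<And>i. i \<in> I \<Longrightarrow> shrinks_to X (L i) (K i)"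
    and E: "\<And>i. i \<in> I \<Longrightarrow> incseq (E i)"
      "\<And>i y. i \<in> I \<Longrightarrow> y \<in> f ` K i \<Longrightarrow> captures_at Y (E i) y \<and> countably_tight_at Y y"
    and A: "A \<subseteq> continuous_maps X Y" "f \<in> compact_open_topology X Y closure_of A - A"
  shows "\<exists>n. infinite ({g \<in> continuous_maps X Y. \<forall>i \<in> I. g \<in> maps_into X Y (L i n) (E i n)} \<inter> A)"
proof (rule ccontr)
  let ?T = "compact_open_topology X Y"
  define D where "D n = {g \<in> continuous_maps X Y. \<forall>i \<in> I. g \<in> maps_into X Y (L i n) (E i n)}" for n
  assume "\<not> ?thesis"
  then have fin: "finite (D n \<inter> A)" for n unfolding D_def by blast
  have mono: "maps_into X Y (L i m) (E i m) \<subseteq> maps_into X Y (L i n) (E i n)"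
    if "i \<in> I" "m \<le> n" for i m n
    using that E(1) shrinks_toD(1)[OF L] by (intro maps_into_mono) (auto simp: incseq_def)
  have Dmono: "D m \<subseteq> D n" if "m \<le> n" for m n
    using mono that unfolding D_def by blast
  \<comment> \<open>The shift by \<open>Suc\<close> makes \<open>\<nu> a\<close> the last stage at
    which \<open>a\<close> fails: \<open>a\<close> lies in \<open>D (Suc (\<nu> a))\<close> but not
    in \<open>D (\<nu> a)\<close>. The exception is \<open>a \<in> D 0\<close>, which the part
    \<open>D 0 \<inter> A\<close> absorbs.\<close>
  define \<nu> where "\<nu> a = (LEAST n. a \<in> D (Suc n))" for a
  define B where "B i = {b \<in> continuous_maps X Y. \<forall>n. b \<notin> maps_into X Y (L i n) (E i n)}" for i
  define C where "C i = {a \<in> A. (\<exists>n. a \<in> D (Suc n)) \<and> a \<notin> maps_into X Y (L i (\<nu> a)) (E i (\<nu> a))}" for i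
  have cover: "A \<subseteq> (D 0 \<inter> A) \<union> \<Union> (B ` I) \<union> \<Union> (C ` I)"
  proof
    fix a assume a: "a \<in> A"
    then have ac: "a \<in> continuous_maps X Y" using A by blast
    show "a \<in> (D 0 \<inter> A) \<union> \<Union> (B ` I) \<union> \<Union> (C ` I)"
    proof (cases "\<exists>n. a \<in> D (Suc n)")
      case True
      then have Suc: "a \<in> D (Suc (\<nu> a))" unfolding \<nu>_def by (rule LeastI_ex)
      show ?thesis
      proof (cases "\<nu> a")
        case 0
        show ?thesis
        proof (cases "a \<in> D 0")
          case False
          then obtain i where "i \<in> I" "a \<notin> maps_into X Y (L i 0) (E i 0)"
            using ac unfolding D_def by blast
          then have "a \<in> C i" using True a 0 unfolding C_def by simp
          then show ?thesis using \<open>i \<in> I\<close> by blast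
        qed (use a in blast)
      next
        case (Suc n)
        then have "a \<notin> D (\<nu> a)" using not_less_Least[of n "\<lambda>n. a \<in> D (Suc n)"] unfolding \<nu>_def by simp
        then obtain i where "i \<in> I" "a \<notin> maps_into X Y (L i (\<nu> a)) (E i (\<nu> a))"
          using ac unfolding D_def by blast
        then have "a \<in> C i" using True a unfolding C_def by simp
        then show ?thesis using \<open>i \<in> I\<close> by blast
      qed
    next
      case False
      have "\<exists>i \<in> I. a \<in> B i"
      proof (rule ccontr)
        assume "\<not> ?thesis"
        then have "\<forall>i \<in> I. \<exists>n. a \<in> maps_into X Y (L i n) (E i n)"
          using ac unfolding B_def by blast
        then obtain m where m: "\<And>i. i \<in> I \<Longrightarrow> a \<in> maps_into X Y (L i (m i)) (E i (m i))"
          by metis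
        \<comment> \<open>Finiteness of \<open>I\<close> gives a common stage; it is a successor
          because the case assumption speaks of \<open>D (Suc n)\<close>.\<close>
        let ?n = "Suc (Max (insert 0 (m ` I)))"
        have "m i \<le> ?n" if "i \<in> I" for i
          using that \<open>finite I\<close> by (simp add: le_SucI)
        then have "a \<in> D ?n" using m mono ac unfolding D_def by blast
        then show False using False by blast
      qed
      then show ?thesis by blast
    qed
  qed
  have "f \<notin> ?T closure_of (D 0 \<inter> A)"
  proof -
    have "closedin ?T (D 0 \<inter> A)"
      using t1_space_compact_open_topology[OF t1] fin A(1)
      unfolding t1_space_closedin_finite by fastforce
    then show ?thesis using A(2) by (simp add: closure_of_closedin)
  qed
  moreover have "f \<notin> ?T closure_of \<Union> (B ` I)"
  proof -
    have "f \<notin> ?T closure_of B i" if "i \<in> I" for i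
      unfolding B_def using that not_in_closure_never_mapped[OF f K L] E by blast
    then show ?thesis using \<open>finite I\<close> by (simp add: closure_of_Union)
  qed
  moreover have "f \<notin> ?T closure_of \<Union> (C ` I)"
  proof -
    have "f \<notin> ?T closure_of C i" if i: "i \<in> I" for i
    proof (rule not_in_closure_finite_fibres[OF t1 f K[OF i] L[OF i], where \<nu> = \<nu> and E = "E i"])
      show "finite {c \<in> C i. \<nu> c < n}" for n
      proof (rule finite_subset[OF _ fin[of n]])
        have "c \<in> D n" if "c \<in> C i" "\<nu> c < n" for c
        proof -
          have "\<exists>n. c \<in> D (Suc n)" using that(1) unfolding C_def by blast
          then have "c \<in> D (Suc (\<nu> c))" unfolding \<nu>_def by (rule LeastI_ex)
          then show ?thesis using Dmono[of "Suc (\<nu> c)" n] that(2) by auto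
        qed
        then show "{c \<in> C i. \<nu> c < n} \<subseteq> D n \<inter> A" unfolding C_def by blast
      qed
    qed (use A E i in \<open>auto simp: C_def\<close>)
    then show ?thesis using \<open>finite I\<close> by (simp add: closure_of_Union)
  qed
  ultimately have "f \<notin> ?T closure_of ((D 0 \<inter> A) \<union> \<Union> (B ` I) \<union> \<Union> (C ` I))"
    by (simp add: closure_of_Un)
  then show False using A(2) closure_of_mono[OF cover] by blast
qed


section \<open>Countable networks\<close>

text \<open>Closing the network under finite unions lets a single member stand between
  \<open>K\<close> and \<open>U\<close>, in place of a finite subfamily.\<close>

lemma k_network_enumeration:
  assumes "countable \<K>" "k_network X \<K>"
  obtains M :: "nat \<Rightarrow> 'a set" where
    "\<And>K U. compactin X K \<Longrightarrow> openin X U \<Longrightarrow> K \<subseteq> U \<Longrightarrow> \<exists>n. K \<subseteq> M n \<and> M n \<subseteq> U"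
proof -
  let ?S = "Union ` {F. finite F \<and> F \<subseteq> \<K>}"
  have "countable ?S"
    using assms(1) by (intro countable_image countable_Collect_finite_subset)
  moreover have "?S \<noteq> {}" by blast
  ultimately have rng: "range (from_nat_into ?S) = ?S" by (intro range_from_nat_into)
  show thesis
  proof (rule that[of "from_nat_into ?S"])
    fix K U
    assume "compactin X K" "openin X U" "K \<subseteq> U"
    then obtain \<F> where "finite \<F>" "\<F> \<subseteq> \<K>" "K \<subseteq> \<Union>\<F>" "\<Union>\<F> \<subseteq> U"
      using assms(2) unfolding k_network_def by meson
    moreover from this have "\<Union>\<F> \<in> range (from_nat_into ?S)" unfolding rng by blast
    then obtain n where "\<Union>\<F> = from_nat_into ?S n" by (rule rangeE)
    ultimately show "\<exists>n. K \<subseteq> from_nat_into ?S n \<and> from_nat_into ?S n \<subseteq> U" by auto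
  qed
qed

text \<open>Each stage depends on \<open>K\<close> only through a finite set of indices, so
  countably many sets arise in all. The factor \<open>topspace X\<close> gives the right value when
  no index qualifies, as an empty intersection is \<open>UNIV\<close>.\<close>

definition outer_approx :: "'a topology \<Rightarrow> (nat \<Rightarrow> 'a set) \<Rightarrow> 'a set \<Rightarrow> nat \<Rightarrow> 'a set" where
  "outer_approx X M K n = topspace X \<inter> \<Inter> (M ` {j. j \<le> n \<and> K \<subseteq> M j})"

definition inner_approx :: "(nat \<Rightarrow> 'b set) \<Rightarrow> 'b set \<Rightarrow> nat \<Rightarrow> 'b set" where
  "inner_approx N U n = \<Union> (N ` {j. j \<le> n \<and> N j \<subseteq> U})"

lemma shrinks_to_outer_approx:
  assumes M: "\<And>K U. compactin X K \<Longrightarrow> openin X U \<Longrightarrow> K \<subseteq> U \<Longrightarrow> \<exists>n. K \<subseteq> M n \<and> M n \<subseteq> U"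
    and K: "compactin X K"
  shows "shrinks_to X (outer_approx X M K) K"
  unfolding shrinks_to_def
proof (intro conjI allI impI)
  show "decseq (outer_approx X M K)"
    unfolding decseq_def outer_approx_def
    by (intro allI impI Int_mono order_refl Inter_anti_mono image_mono) auto
  show "K \<subseteq> outer_approx X M K n" "outer_approx X M K n \<subseteq> topspace X" for n
    using compactin_subset_topspace[OF K] unfolding outer_approx_def by blast+
  fix U
  assume "openin X U \<and> K \<subseteq> U"
  then obtain n where "K \<subseteq> M n" "M n \<subseteq> U" using M K by blast
  then show "\<exists>n. outer_approx X M K n \<subseteq> U"
    by (intro exI[of _ n]) (auto simp: outer_approx_def)
qed

lemma incseq_inner_approx: "incseq (inner_approx N U)"
  unfolding incseq_def inner_approx_def
  by (intro allI impI Union_mono image_mono) auto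

lemma inner_approx_subset: "inner_approx N U n \<subseteq> U"
  unfolding inner_approx_def by blast

lemma subset_inner_approx: "N n \<subseteq> U \<Longrightarrow> N n \<subseteq> inner_approx N U n"
  unfolding inner_approx_def by blast

text \<open>Indexing by finite sets of pairs of finite index sets makes countability immediate; the
  approximations of all \<open>K\<close> and \<open>U\<close> at every stage are among these
  sets.\<close>

definition mapping_family ::
    "'a topology \<Rightarrow> 'b topology \<Rightarrow> (nat \<Rightarrow> 'a set) \<Rightarrow> (nat \<Rightarrow> 'b set) \<Rightarrow> ('a \<Rightarrow> 'b) set set" where
  "mapping_family X Y M N =
     (\<lambda>P. {g \<in> continuous_maps X Y.
             \<forall>p \<in> P. g \<in> maps_into X Y (topspace X \<inter> \<Inter> (M ` fst p)) (\<Union> (N ` snd p))}) `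
     {P. finite P \<and> P \<subseteq> {a. finite a} \<times> {b. finite b}}"

lemma countable_mapping_family: "countable (mapping_family X Y M N)"
  unfolding mapping_family_def
  by (intro countable_image countable_Collect_finite_subset countable_SIGMA countable_Collect_finite)

lemma mapping_family_subset: "mapping_family X Y M N \<subseteq> Pow (continuous_maps X Y)"
  unfolding mapping_family_def by auto

lemma approx_in_mapping_family:
  assumes "finite I"
  shows "{g \<in> continuous_maps X Y.
      \<forall>i \<in> I. g \<in> maps_into X Y (outer_approx X M (fst i) n) (inner_approx N (snd i) n)}
    \<in> mapping_family X Y M N"
  unfolding mapping_family_def
proof (rule image_eqI)
  let ?P = "(\<lambda>i. ({j. j \<le> n \<and> fst i \<subseteq> M j}, {j. j \<le> n \<and> N j \<subseteq> snd i})) ` I"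
  show "?P \<in> {P. finite P \<and> P \<subseteq> {a. finite a} \<times> {b. finite b}}"
    using assms by auto
  show "{g \<in> continuous_maps X Y.
      \<forall>i \<in> I. g \<in> maps_into X Y (outer_approx X M (fst i) n) (inner_approx N (snd i) n)} =
    {g \<in> continuous_maps X Y.
      \<forall>p \<in> ?P. g \<in> maps_into X Y (topspace X \<inter> \<Inter> (M ` fst p)) (\<Union> (N ` snd p))}"
    unfolding outer_approx_def inner_approx_def by simp
qed

lemma countable_members_meeting_image:
  assumes M: "\<And>x U. openin X U \<Longrightarrow> x \<in> U \<Longrightarrow> \<exists>n::nat. x \<in> M n \<and> M n \<subseteq> U"
    and f: "continuous_map X Y f" and \<N>: "sigma_locally_finite_in Y \<N>"
  shows "countable {N \<in> \<N>. N \<inter> f ` topspace X \<noteq> {}}"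
proof -
  obtain \<F> :: "nat \<Rightarrow> 'b set set" where \<F>: "\<And>k. locally_finite_in Y (\<F> k)" "\<N> = (\<Union>k. \<F> k)"
    using \<N> unfolding sigma_locally_finite_in_def by blast
  let ?R = "\<lambda>k n. {N \<in> \<F> k. N \<inter> f ` M n \<noteq> {}}"
  have "{N \<in> \<N>. N \<inter> f ` topspace X \<noteq> {}} \<subseteq> (\<Union>k. \<Union>n \<in> {n. finite (?R k n)}. ?R k n)"
  proof
    fix N
    assume "N \<in> {N \<in> \<N>. N \<inter> f ` topspace X \<noteq> {}}"
    then obtain k x where k: "N \<in> \<F> k" and x: "x \<in> topspace X" "f x \<in> N"
      using \<F>(2) by blast
    have "f x \<in> topspace Y" using f x unfolding continuous_map_def by blast
    then obtain V where V: "openin Y V" "f x \<in> V" "finite {U \<in> \<F> k. U \<inter> V \<noteq> {}}"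
      using \<F>(1)[of k] unfolding locally_finite_in_def by blast
    have "openin X {z \<in> topspace X. f z \<in> V}"
      using openin_continuous_map_preimage[OF f V(1)] .
    then obtain n where n: "x \<in> M n" "M n \<subseteq> {z \<in> topspace X. f z \<in> V}"
      using M x V(2) by blast
    have "finite (?R k n)" by (rule finite_subset[OF _ V(3)]) (use n in blast)
    moreover have "N \<in> ?R k n" using k x n by blast
    ultimately show "N \<in> (\<Union>k. \<Union>n \<in> {n. finite (?R k n)}. ?R k n)" by blast
  qed
  moreover have "countable (\<Union>k. \<Union>n \<in> {n. finite (?R k n)}. ?R k n)"
    by (intro countable_UN) (auto intro: countable_finite)
  ultimately show ?thesis using countable_subset by blast
qed

section \<open>Spaces with a \<open>\<sigma>\<close>-locally finite \<open>cp\<close>-network\<close>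

text \<open>In contrast to \<open>cp_network_at\<close>, a member around \<open>y\<close> inside
  \<open>V\<close> is demanded at isolated points too; it yields the first half of
  \<open>captures_at\<close>.\<close>

definition cp_sequence_at :: "'a topology \<Rightarrow> (nat \<Rightarrow> 'a set) \<Rightarrow> 'a \<Rightarrow> bool" where
  "cp_sequence_at Y N y \<longleftrightarrow> y \<in> topspace Y \<and> (\<forall>V. openin Y V \<and> y \<in> V \<longrightarrow>
     (\<exists>n. y \<in> N n \<and> N n \<subseteq> V) \<and>
     (\<forall>A. A \<subseteq> topspace Y \<and> y \<in> Y closure_of A - A \<longrightarrow> (\<exists>n. N n \<subseteq> V \<and> infinite (N n \<inter> A))))"

lemma captures_at_inner_approx:
  assumes N: "cp_sequence_at Y N y" and U: "openin Y U" "y \<in> U"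
  shows "captures_at Y (inner_approx N U) y"
  unfolding captures_at_def
proof (intro conjI allI impI)
  show "\<exists>n. y \<in> inner_approx N U n"
    using N U subset_inner_approx unfolding cp_sequence_at_def by (metis subsetD)
  fix A
  assume "A \<subseteq> topspace Y \<and> y \<in> Y closure_of A - A"
  then obtain n where n: "N n \<subseteq> U" "infinite (N n \<inter> A)"
    using N U unfolding cp_sequence_at_def by meson
  have "N n \<inter> A \<subseteq> inner_approx N U n \<inter> A" using subset_inner_approx[of N n U] n(1) by blast
  then show "\<exists>n. infinite (inner_approx N U n \<inter> A)" using n(2) infinite_super by blast
qed

text \<open>One point chosen from each nonempty \<open>N n \<inter> A\<close> suffices, since every
  neighborhood of \<open>y\<close> contains some \<open>N n\<close> meeting
  \<open>A\<close>.\<close>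

lemma cp_sequence_at_imp_countably_tight_at:
  assumes N: "cp_sequence_at Y N y"
  shows "countably_tight_at Y y"
  unfolding countably_tight_at_def
proof (intro allI impI)
  fix A
  assume A: "A \<subseteq> topspace Y \<and> y \<in> Y closure_of A"
  show "\<exists>B. countable B \<and> B \<subseteq> A \<and> y \<in> Y closure_of B"
  proof (cases "y \<in> A")
    case True
    have "y \<in> Y closure_of {y}" using N unfolding cp_sequence_at_def in_closure_of by blast
    then show ?thesis using True by (intro exI[of _ "{y}"]) auto
  next
    case False
    define B where "B = (\<lambda>n. SOME z. z \<in> N n \<inter> A) ` {n. N n \<inter> A \<noteq> {}}"
    have some: "(SOME z. z \<in> N n \<inter> A) \<in> N n \<inter> A" if "N n \<inter> A \<noteq> {}" for n
      using that some_in_eq[of "N n \<inter> A"] by blast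
    have "y \<in> Y closure_of B"
      unfolding in_closure_of
    proof (intro conjI allI impI)
      show "y \<in> topspace Y" using N unfolding cp_sequence_at_def by blast
      fix V
      assume "y \<in> V \<and> openin Y V"
      then obtain n where "N n \<subseteq> V" "infinite (N n \<inter> A)"
        using N A False unfolding cp_sequence_at_def by (meson DiffI)
      moreover from this have "N n \<inter> A \<noteq> {}" by auto
      ultimately show "\<exists>z. z \<in> B \<and> z \<in> V" using some[of n] unfolding B_def by blast
    qed
    moreover have "countable B" "B \<subseteq> A" using some unfolding B_def by auto
    ultimately show ?thesis by blast
  qed
qed

text \<open>A \<open>cp\<close>-network in the sense of \<^const>\<open>cp_network\<close> need not cover the isolated points of \<open>Y\<close>.
  Their singletons have to be added; countably many suffice, since only those in the image of \<open>f\<close>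
  matter and each of them is determined by a member of the network of \<open>X\<close>.\<close>

lemma cp_sequence_along_map:
  assumes M: "\<And>x U. openin X U \<Longrightarrow> x \<in> U \<Longrightarrow> \<exists>n::nat. x \<in> M n \<and> M n \<subseteq> U"
    and f: "continuous_map X Y f"
    and \<N>: "sigma_locally_finite_in Y \<N>" "cp_network Y \<N>"
  obtains N :: "nat \<Rightarrow> 'b set" where "\<And>x. x \<in> topspace X \<Longrightarrow> cp_sequence_at Y N (f x)"
proof -
  let ?N1 = "{N \<in> \<N>. N \<inter> f ` topspace X \<noteq> {}}"
  let ?N2 = "{{f x} | x. x \<in> topspace X \<and> openin Y {f x}}"
  let ?S = "insert {} (?N1 \<union> ?N2)"
  \<comment> \<open>An \<open>M n\<close> inside the preimage of an isolated value determines that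
    value, whichever of its points is chosen.\<close>
  have "?N2 \<subseteq> range (\<lambda>n. {f (SOME x. x \<in> M n)})"
  proof clarify
    fix x
    assume x: "x \<in> topspace X" "openin Y {f x}"
    have "openin X {z \<in> topspace X. f z \<in> {f x}}"
      using openin_continuous_map_preimage[OF f x(2)] .
    then obtain n where n: "x \<in> M n" "M n \<subseteq> {z \<in> topspace X. f z \<in> {f x}}"
      using M x(1) by blast
    have "(SOME x. x \<in> M n) \<in> M n" using n(1) by (rule someI)
    then have "f (SOME x. x \<in> M n) = f x" using n(2) by blast
    then show "{f x} \<in> range (\<lambda>n. {f (SOME x. x \<in> M n)})" by (intro range_eqI[of _ _ n]) simp
  qed
  then have "countable ?N2" by (rule countable_subset) simp
  moreover have "countable ?N1" using countable_members_meeting_image[OF M f \<N>(1)] by blast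
  ultimately have "countable ?S" by simp
  then have rng: "range (from_nat_into ?S) = ?S" by (intro range_from_nat_into) auto
  have ex: "\<exists>n. from_nat_into ?S n = N" if "N \<in> ?S" for N
    using that rng by (metis (no_types, lifting) rangeE)
  show thesis
  proof (rule that[of "from_nat_into ?S"])
    fix x
    assume x: "x \<in> topspace X"
    then have fx: "f x \<in> topspace Y" using f unfolding continuous_map_def by blast
    have cp: "cp_network_at Y (f x) \<N>" using \<N>(2) fx unfolding cp_network_def by blast
    have non: "\<exists>n. f x \<in> from_nat_into ?S n \<and> from_nat_into ?S n \<subseteq> V \<and> infinite (from_nat_into ?S n \<inter> A)"
      if V: "openin Y V" "f x \<in> V" and A: "A \<subseteq> topspace Y" "f x \<in> Y closure_of A - A" for V A
    proof -
      have "\<not> openin Y {f x}"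
      proof
        assume "openin Y {f x}"
        then have "\<exists>z. z \<in> A \<and> z \<in> {f x}" using A(2) in_closure_of[of "f x" Y A] by blast
        then show False using A(2) by blast
      qed
      moreover have "neighborhood_in Y (f x) V"
        using V openin_subset unfolding neighborhood_in_def by blast
      ultimately obtain N where N: "N \<in> \<N>" "f x \<in> N" "N \<subseteq> V" "infinite (N \<inter> A)"
        using cp A unfolding cp_network_at_def by meson
      then have "N \<in> ?S" using x by blast
      then obtain n where "from_nat_into ?S n = N" using ex by blast
      then show ?thesis using N by (intro exI[of _ n]) simp
    qed
    have "\<exists>n. f x \<in> from_nat_into ?S n \<and> from_nat_into ?S n \<subseteq> V" if V: "openin Y V" "f x \<in> V" for V
    proof (cases "openin Y {f x}")
      case True
      then have "{f x} \<in> ?S" using x by blast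
      then obtain n where "from_nat_into ?S n = {f x}" using ex by blast
      then show ?thesis using V by (intro exI[of _ n]) simp
    next
      case False
      \<comment> \<open>At a non-isolated value the accumulation clause, applied to the complement
        of the point, also supplies a member around \<open>f x\<close> inside
        \<open>V\<close>.\<close>
      have "f x \<in> Y closure_of (topspace Y - {f x})"
        unfolding in_closure_of
      proof (intro conjI allI impI)
        fix T
        assume T: "f x \<in> T \<and> openin Y T"
        then have "T \<noteq> {f x}" "T \<subseteq> topspace Y" using False openin_subset by auto
        then show "\<exists>y. y \<in> topspace Y - {f x} \<and> y \<in> T" using T by blast
      qed (rule fx)
      then show ?thesis using non[OF V, of "topspace Y - {f x}"] by blast
    qed
    then show "cp_sequence_at Y (from_nat_into ?S) (f x)"
      using fx non unfolding cp_sequence_at_def by meson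
  qed
qed

text \<open>The family depends on \<open>f\<close> only through \<open>N\<close>, and is fixed
  before \<open>U\<close> and \<open>A\<close> are given. The sets \<open>?D n\<close> attached to a
  basic neighborhood inside \<open>U\<close> belong to it and stay in \<open>U\<close>, because
  \<open>?L i n\<close> contains \<open>fst i\<close> and \<open>?E i n\<close> lies in
  \<open>snd i\<close>.\<close>

lemma strong_Pytkeev_property_compact_open_topology:
  assumes M: "\<And>K U. compactin X K \<Longrightarrow> openin X U \<Longrightarrow> K \<subseteq> U \<Longrightarrow> \<exists>n::nat. K \<subseteq> M n \<and> M n \<subseteq> U"
    and Y: "frakP_space Y"
  shows "strong_Pytkeev_property (compact_open_topology X Y)"
  unfolding strong_Pytkeev_property_def topspace_compact_open_topology
proof
  let ?T = "compact_open_topology X Y"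
  fix f
  assume f: "f \<in> continuous_maps X Y"
  then have fc: "continuous_map X Y f" unfolding continuous_maps_def by blast
  have t1: "t1_space Y" using Y Hausdorff_imp_t1_space unfolding frakP_space_def by blast
  have M1: "\<exists>n. x \<in> M n \<and> M n \<subseteq> U" if "openin X U" "x \<in> U" for x U
    using M[of "{x}" U] that openin_subset by fastforce
  obtain \<N> where "sigma_locally_finite_in Y \<N>" "cp_network Y \<N>"
    using Y unfolding frakP_space_def by blast
  then obtain N where N: "\<And>x. x \<in> topspace X \<Longrightarrow> cp_sequence_at Y N (f x)"
    using cp_sequence_along_map[OF M1 fc] by blast
  have main: "\<exists>D\<in>mapping_family X Y M N. D \<subseteq> U \<and> infinite (D \<inter> A)"
    if U: "neighborhood_in ?T f U" and A: "A \<subseteq> continuous_maps X Y" "f \<in> ?T closure_of A - A" for U A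
  proof -
    obtain W where W: "openin ?T W" "f \<in> W" "W \<subseteq> U"
      using U unfolding neighborhood_in_def by blast
    obtain I where I: "finite I"
      "\<And>i. i \<in> I \<Longrightarrow> compactin X (fst i) \<and> openin Y (snd i) \<and> f \<in> maps_into X Y (fst i) (snd i)"
      "{g \<in> continuous_maps X Y. \<forall>i \<in> I. g \<in> maps_into X Y (fst i) (snd i)} \<subseteq> W"
      using openin_compact_open_topologyE[OF W(1,2)] by blast
    let ?L = "\<lambda>i. outer_approx X M (fst i)" and ?E = "\<lambda>i. inner_approx N (snd i)"
    let ?D = "\<lambda>n. {g \<in> continuous_maps X Y. \<forall>i \<in> I. g \<in> maps_into X Y (?L i n) (?E i n)}"
    have L: "shrinks_to X (?L i) (fst i)" if "i \<in> I" for i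
      using shrinks_to_outer_approx[OF M] I(2)[OF that] by blast
    have E: "captures_at Y (?E i) y \<and> countably_tight_at Y y" if i: "i \<in> I" and y: "y \<in> f ` fst i" for i y
    proof -
      have y': "y \<in> snd i" using I(2)[OF i] y unfolding maps_into_def by blast
      have cp: "cp_sequence_at Y N y"
        using N y I(2)[OF i] compactin_subset_topspace by blast
      have "openin Y (snd i)" using I(2)[OF i] by blast
      then show ?thesis
        using captures_at_inner_approx[OF cp _ y'] cp_sequence_at_imp_countably_tight_at[OF cp] by simp
    qed
    have "\<exists>n. infinite (?D n \<inter> A)"
      by (rule infinite_Int_maps_into[OF t1 f I(1) _ L incseq_inner_approx E A]) (use I(2) in auto)
    then obtain n where "infinite (?D n \<inter> A)" ..
    moreover have "?D n \<in> mapping_family X Y M N" by (rule approx_in_mapping_family[OF I(1)])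
    moreover have "?D n \<subseteq> U"
    proof -
      have "maps_into X Y (?L i n) (?E i n) \<subseteq> maps_into X Y (fst i) (snd i)" if "i \<in> I" for i
        using shrinks_toD(2)[OF L[OF that]] inner_approx_subset by (intro maps_into_mono)
      then show ?thesis using I(3) W(3) by blast
    qed
    ultimately show ?thesis by blast
  qed
  show "\<exists>\<D>. countable \<D> \<and> \<D> \<subseteq> Pow (continuous_maps X Y) \<and>
      (\<forall>U A. neighborhood_in ?T f U \<and> A \<subseteq> continuous_maps X Y \<and> f \<in> ?T closure_of A - A \<longrightarrow>
        (\<exists>D\<in>\<D>. D \<subseteq> U \<and> infinite (D \<inter> A)))"
    by (intro exI[of _ "mapping_family X Y M N"] conjI allI impI)
      ((rule countable_mapping_family mapping_family_subset | (rule main; simp))+)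
qed

section \<open>Spaces with a \<open>\<sigma>\<close>-locally finite \<open>ck\<close>-network\<close>

text \<open>Evaluation is continuous on \<open>\<C>\<close> times the compact set
  \<open>K' 0\<close>. The pairs evaluated outside \<open>G\<close> form a compact set
  \<open>Z\<close>; its projection to \<open>X\<close> is closed and misses \<open>K\<close>, hence
  misses some \<open>L m\<close>. The image of \<open>\<C> \<times> K' m\<close> under evaluation is
  then the required \<open>S\<close>.\<close>

lemma compactin_maps_into_tail:
  assumes X: "Hausdorff_space X" and K: "compactin X K" and L: "shrinks_to X L K"
    and x: "\<And>n. x n \<in> L n"
    and G: "openin Y G" and \<C>: "compactin (compact_open_topology X Y) \<C>" "\<C> \<subseteq> maps_into X Y K G"
  obtains m S where "compactin Y S" "S \<subseteq> G" "\<And>c n. c \<in> \<C> \<Longrightarrow> m \<le> n \<Longrightarrow> c (x n) \<in> S"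
proof -
  let ?T = "compact_open_topology X Y"
  define K' where "K' m = K \<union> x ` {m..}" for m
  have K': "compactin X (K' m)" for m
    unfolding K'_def
  proof (rule compactin_Un_shrinking[OF L K, where \<nu> = id])
    show "finite {c \<in> {m..}. id c < n}" for n by (rule finite_subset[of _ "{..n}"]) auto
  qed (use x in simp)
  let ?X' = "subtopology X (K' 0)"
  let ?P = "prod_topology ?T ?X'"
  let ?ev = "\<lambda>(c, z). c z"
  have sub: "K' m \<subseteq> K' 0" for m unfolding K'_def by auto
  have ev: "continuous_map ?P Y ?ev"
    by (rule continuous_map_evaluation_on_compact[OF X K'])
  have \<C>K': "compactin ?P (\<C> \<times> K' m)" for m
    using \<C>(1) K' sub by (simp add: compactin_Times compactin_subtopology)
  define Z where "Z = {p \<in> topspace ?P. ?ev p \<in> topspace Y - G} \<inter> (\<C> \<times> K' 0)"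
  have "closedin ?P {p \<in> topspace ?P. ?ev p \<in> topspace Y - G}"
    by (rule closedin_continuous_map_preimage[OF ev]) (use G in auto)
  then have "compactin ?P Z"
    unfolding Z_def using \<C>K' by (rule closed_Int_compactin)
  then have "compactin ?X' (snd ` Z)" by (rule image_compactin) (rule continuous_map_snd)
  then have closed: "closedin X (snd ` Z)"
    using compactin_imp_closedin[OF X] by (simp add: compactin_subtopology)
  have KG: "c z \<in> G" if "c \<in> \<C>" "z \<in> K" for c z
    using that \<C>(2) unfolding maps_into_def by blast
  then have "K \<inter> snd ` Z = {}" unfolding Z_def by auto
  with closed obtain m where m: "L m \<subseteq> topspace X - snd ` Z"
    using shrinks_toD(4)[OF L, of "topspace X - snd ` Z"] compactin_subset_topspace[OF K] by blast
  have xG: "c (x n) \<in> G" if "c \<in> \<C>" "m \<le> n" for c n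
  proof -
    have c: "c \<in> continuous_maps X Y" using that(1) \<C>(2) unfolding maps_into_def by blast
    have xX: "x n \<in> topspace X" using x shrinks_toD(3)[OF L] by blast
    have "x n \<in> K' 0" unfolding K'_def by simp
    moreover have "(c, x n) \<in> topspace ?P" using c xX \<open>x n \<in> K' 0\<close> by simp
    moreover have "c (x n) \<in> topspace Y"
      using c xX unfolding continuous_maps_def continuous_map_def by blast
    moreover have "x n \<notin> snd ` Z" using m x[of n] shrinks_toD(1)[OF L that(2)] by blast
    ultimately show ?thesis using that(1) unfolding Z_def by force
  qed
  show thesis
  proof (rule that)
    show "compactin Y (?ev ` (\<C> \<times> K' m))" by (rule image_compactin[OF \<C>K' ev])
    show "?ev ` (\<C> \<times> K' m) \<subseteq> G"
      using xG KG unfolding K'_def by auto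
    show "c (x n) \<in> ?ev ` (\<C> \<times> K' m)" if "c \<in> \<C>" "m \<le> n" for c n
      using that unfolding K'_def by (intro image_eqI[of _ _ "(c, x n)"]) auto
  qed
qed

text \<open>Regularity puts a closed \<open>F y\<close> between a smaller neighborhood
  \<open>W y\<close> and the given one. A compact subset of finitely many \<open>W y\<close> splits
  into compact pieces \<open>F y \<inter> S\<close>, each absorbed at some stage, and
  \<open>E\<close> increases.\<close>

lemma neighborhood_absorbing_compact_sets:
  assumes Y: "regular_space Y" and Q: "compactin Y Q" and E: "incseq E"
    and V: "\<And>y. y \<in> Q \<Longrightarrow>
      \<exists>V. openin Y V \<and> y \<in> V \<and> (\<forall>S. compactin Y S \<and> S \<subseteq> V \<longrightarrow> (\<exists>n. S \<subseteq> E n))"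
  obtains G where "openin Y G" "Q \<subseteq> G" "\<And>S. compactin Y S \<Longrightarrow> S \<subseteq> G \<Longrightarrow> \<exists>n. S \<subseteq> E n"
proof -
  have "\<exists>W F. openin Y W \<and> closedin Y F \<and> y \<in> W \<and> W \<subseteq> F \<and>
      (\<forall>S. compactin Y S \<and> S \<subseteq> F \<longrightarrow> (\<exists>n. S \<subseteq> E n))" if y: "y \<in> Q" for y
  proof -
    obtain V where "openin Y V" "y \<in> V" and V': "\<forall>S. compactin Y S \<and> S \<subseteq> V \<longrightarrow> (\<exists>n. S \<subseteq> E n)"
      using V[OF y] by blast
    then obtain W F where "openin Y W" "closedin Y F" "y \<in> W" "W \<subseteq> F" "F \<subseteq> V"
      using Y unfolding neighbourhood_base_of_closedin[symmetric] neighbourhood_base_of by meson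
    moreover from this have "\<forall>S. compactin Y S \<and> S \<subseteq> F \<longrightarrow> (\<exists>n. S \<subseteq> E n)"
      using V' by blast
    ultimately show ?thesis by blast
  qed
  then obtain W F where WF: "\<And>y. y \<in> Q \<Longrightarrow> openin Y (W y) \<and> closedin Y (F y) \<and> y \<in> W y \<and>
      W y \<subseteq> F y \<and> (\<forall>S. compactin Y S \<and> S \<subseteq> F y \<longrightarrow> (\<exists>n. S \<subseteq> E n))"
    by metis
  then have W: "\<And>y. y \<in> Q \<Longrightarrow> openin Y (W y)" "\<And>y. y \<in> Q \<Longrightarrow> y \<in> W y"
    and F: "\<And>y. y \<in> Q \<Longrightarrow> closedin Y (F y)" "\<And>y. y \<in> Q \<Longrightarrow> W y \<subseteq> F y"
      "\<And>y S. y \<in> Q \<Longrightarrow> compactin Y S \<Longrightarrow> S \<subseteq> F y \<Longrightarrow> \<exists>n. S \<subseteq> E n"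
    by blast+
  have QW: "Q \<subseteq> (\<Union>y\<in>Q. W y)" using W(2) by blast
  obtain J where J: "finite J" "J \<subseteq> Q" "Q \<subseteq> (\<Union>y\<in>J. W y)"
    by (rule compactin_finite_subcover_image[OF Q, of Q W, OF W(1) QW]) (assumption, rule that)
  show thesis
  proof (rule that[of "\<Union>y\<in>J. W y"])
    show "openin Y (\<Union>y\<in>J. W y)" using J W(1) by blast
    show "Q \<subseteq> (\<Union>y\<in>J. W y)" by (rule J)
    fix S
    assume S: "compactin Y S" "S \<subseteq> (\<Union>y\<in>J. W y)"
    have "\<exists>n. F y \<inter> S \<subseteq> E n" if "y \<in> J" for y
      by (rule F(3)) (use that J F(1) S in \<open>auto intro: closed_Int_compactin\<close>)
    then obtain n where n: "\<And>y. y \<in> J \<Longrightarrow> F y \<inter> S \<subseteq> E (n y)" by metis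
    let ?n = "Max (insert 0 (n ` J))"
    have "E (n y) \<subseteq> E ?n" if "y \<in> J" for y
      using E that J(1) unfolding incseq_def by simp
    moreover have "S \<subseteq> (\<Union>y\<in>J. F y \<inter> S)" using S(2) F(2) J(2) by blast
    ultimately have "S \<subseteq> E ?n" using n by blast
    then show "\<exists>n. S \<subseteq> E n" by blast
  qed
qed

text \<open>If every stage failed, there would be \<open>c n \<in> \<C>\<close> and
  \<open>x n \<in> L n\<close> with \<open>c n (x n) \<notin> E n\<close>. The tail lemma confines
  these values, from some index on, to one compact subset of \<open>G\<close>, which a single
  \<open>E n\<close> absorbs.\<close>

lemma neighborhood_absorbing_compact_sets_of_maps:
  assumes X: "Hausdorff_space X" and Y: "regular_space Y"
    and f: "continuous_map X Y f" and K: "compactin X K" and L: "shrinks_to X L K"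
    and E: "incseq E"
    and V: "\<And>y. y \<in> f ` K \<Longrightarrow>
      \<exists>V. openin Y V \<and> y \<in> V \<and> (\<forall>S. compactin Y S \<and> S \<subseteq> V \<longrightarrow> (\<exists>n. S \<subseteq> E n))"
  obtains G where "openin Y G" "f ` K \<subseteq> G"
    "\<And>\<C>. compactin (compact_open_topology X Y) \<C> \<Longrightarrow> \<C> \<subseteq> maps_into X Y K G \<Longrightarrow>
       \<exists>n. \<C> \<subseteq> maps_into X Y (L n) (E n)"
proof -
  obtain G where G: "openin Y G" "f ` K \<subseteq> G"
    and absorb: "\<And>S. compactin Y S \<Longrightarrow> S \<subseteq> G \<Longrightarrow> \<exists>n. S \<subseteq> E n"
    using neighborhood_absorbing_compact_sets[OF Y image_compactin[OF K f] E V] by blast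
  have "\<exists>n. \<C> \<subseteq> maps_into X Y (L n) (E n)"
    if \<C>: "compactin (compact_open_topology X Y) \<C>" "\<C> \<subseteq> maps_into X Y K G" for \<C>
  proof (rule ccontr)
    assume "\<not> ?thesis"
    then have "\<forall>n. \<exists>c x. c \<in> \<C> \<and> x \<in> L n \<and> c x \<notin> E n"
      using \<C>(2) unfolding maps_into_def by blast
    then obtain c x where cx: "\<And>n. c n \<in> \<C>" "\<And>n. x n \<in> L n" "\<And>n. c n (x n) \<notin> E n"
      by metis
    obtain m S where S: "compactin Y S" "S \<subseteq> G" "\<And>c n. c \<in> \<C> \<Longrightarrow> m \<le> n \<Longrightarrow> c (x n) \<in> S"
      by (rule compactin_maps_into_tail[OF X K L cx(2) G(1) \<C>]) (rule that)
    obtain n where "S \<subseteq> E n" using absorb[OF S(1,2)] by blast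
    then have "S \<subseteq> E (max m n)" using E unfolding incseq_def by (meson max.cobounded2 subset_trans)
    then show False using S(3)[of "c (max m n)" "max m n"] cx by auto
  qed
  then show thesis using that G by blast
qed

lemma ck_sequence_along_map:
  assumes M: "\<And>x U. openin X U \<Longrightarrow> x \<in> U \<Longrightarrow> \<exists>n::nat. x \<in> M n \<and> M n \<subseteq> U"
    and f: "continuous_map X Y f"
    and \<N>: "sigma_locally_finite_in Y \<N>" "ck_network Y \<N>"
  obtains N :: "nat \<Rightarrow> 'b set" where
    "\<And>x V. x \<in> topspace X \<Longrightarrow> openin Y V \<Longrightarrow> f x \<in> V \<Longrightarrow>
       \<exists>W. openin Y W \<and> f x \<in> W \<and> (\<forall>S. compactin Y S \<and> S \<subseteq> W \<longrightarrow> (\<exists>n. S \<subseteq> inner_approx N V n))"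
proof -
  let ?S = "insert {} {N \<in> \<N>. N \<inter> f ` topspace X \<noteq> {}}"
  define e where "e = from_nat_into ?S"
  have "countable ?S" using countable_members_meeting_image[OF M f \<N>(1)] by simp
  then have rng: "range e = ?S" unfolding e_def by (intro range_from_nat_into) auto
  show thesis
  proof (rule that[of e])
    fix x V
    assume x: "x \<in> topspace X" and V: "openin Y V" "f x \<in> V"
    have "f x \<in> topspace Y" using f x unfolding continuous_map_def by blast
    then have "ck_network_at Y (f x) \<N>" using \<N>(2) unfolding ck_network_def by blast
    moreover have "neighborhood_in Y (f x) V"
      using V openin_subset unfolding neighborhood_in_def by blast
    ultimately obtain U where "neighborhood_in Y (f x) U"
      and U: "\<forall>K. compactin Y K \<and> K \<subseteq> U \<longrightarrow>
        (\<exists>\<F>. finite \<F> \<and> \<F> \<subseteq> \<N> \<and> f x \<in> \<Inter>\<F> \<and> K \<subseteq> \<Union>\<F> \<and> \<Union>\<F> \<subseteq> V)"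
      unfolding ck_network_at_def by meson
    then obtain W where W: "openin Y W" "f x \<in> W" "W \<subseteq> U"
      unfolding neighborhood_in_def by blast
    have "\<exists>n. S \<subseteq> inner_approx e V n" if S: "compactin Y S" "S \<subseteq> W" for S
    proof -
      obtain \<F> where \<F>: "finite \<F>" "\<F> \<subseteq> \<N>" "f x \<in> \<Inter>\<F>" "S \<subseteq> \<Union>\<F>" "\<Union>\<F> \<subseteq> V"
        using U S W(3) by (meson subset_trans)
      \<comment> \<open>Here the requirement \<open>f x \<in> \<Inter>\<F>\<close> of a
        \<open>ck\<close>-network is decisive: every member of \<open>\<F>\<close> meets the image
        of \<open>f\<close> and so survives in the countable subfamily.\<close>
      have "\<F> \<subseteq> ?S" using \<F>(2,3) x by blast
      then have "\<F> \<subseteq> range e" by (simp only: rng)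
      then obtain J where J: "finite J" "\<F> = e ` J"
        using finite_subset_image[OF \<F>(1), of e UNIV] by blast
      have "j \<le> Max (insert 0 J)" if "j \<in> J" for j using that J(1) by simp
      then have "\<Union>\<F> \<subseteq> inner_approx e V (Max (insert 0 J))"
        using \<F>(5) unfolding inner_approx_def J(2) by blast
      then show ?thesis using \<F>(4) by blast
    qed
    then show "\<exists>W. openin Y W \<and> f x \<in> W \<and>
        (\<forall>S. compactin Y S \<and> S \<subseteq> W \<longrightarrow> (\<exists>n. S \<subseteq> inner_approx e V n))"
      using W by blast
  qed
qed

text \<open>The neighborhood \<open>U\<close> is cut out by the absorbing sets \<open>G i\<close>. A
  compact part of it fits into one set \<open>?D k\<close>, so the finite family can be taken to be
  the singleton \<open>{?D k}\<close>.\<close>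

lemma countable_ck_network_at_compact_open_topology:
  assumes M: "\<And>K U. compactin X K \<Longrightarrow> openin X U \<Longrightarrow> K \<subseteq> U \<Longrightarrow> \<exists>n::nat. K \<subseteq> M n \<and> M n \<subseteq> U"
    and X: "Hausdorff_space X" and Y: "strict_aleph_space Y" and f: "f \<in> continuous_maps X Y"
  shows "\<exists>\<N>. countable \<N> \<and> ck_network_at (compact_open_topology X Y) f \<N>"
proof -
  let ?T = "compact_open_topology X Y"
  have fc: "continuous_map X Y f" using f unfolding continuous_maps_def by blast
  have reg: "regular_space Y" using Y unfolding strict_aleph_space_def by blast
  have M1: "\<exists>n. x \<in> M n \<and> M n \<subseteq> U" if "openin X U" "x \<in> U" for x U
    using M[of "{x}" U] that openin_subset by fastforce
  obtain \<N> where "sigma_locally_finite_in Y \<N>" "ck_network Y \<N>"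
    using Y unfolding strict_aleph_space_def by blast
  then obtain N :: "nat \<Rightarrow> 'b set" where N: "\<And>x V. x \<in> topspace X \<Longrightarrow> openin Y V \<Longrightarrow> f x \<in> V \<Longrightarrow>
       \<exists>W. openin Y W \<and> f x \<in> W \<and> (\<forall>S. compactin Y S \<and> S \<subseteq> W \<longrightarrow> (\<exists>n. S \<subseteq> inner_approx N V n))"
    using ck_sequence_along_map[OF M1 fc] by blast
  have main: "\<exists>U. neighborhood_in ?T f U \<and>
      (\<forall>\<C>. compactin ?T \<C> \<and> \<C> \<subseteq> U \<longrightarrow>
        (\<exists>\<F>. finite \<F> \<and> \<F> \<subseteq> mapping_family X Y M N \<and> f \<in> \<Inter>\<F> \<and> \<C> \<subseteq> \<Union>\<F> \<and> \<Union>\<F> \<subseteq> V))"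
    if V: "neighborhood_in ?T f V" for V
  proof -
    obtain W where W: "openin ?T W" "f \<in> W" "W \<subseteq> V"
      using V unfolding neighborhood_in_def by blast
    obtain I where I: "finite I"
      "\<And>i. i \<in> I \<Longrightarrow> compactin X (fst i) \<and> openin Y (snd i) \<and> f \<in> maps_into X Y (fst i) (snd i)"
      "{g \<in> continuous_maps X Y. \<forall>i \<in> I. g \<in> maps_into X Y (fst i) (snd i)} \<subseteq> W"
      using openin_compact_open_topologyE[OF W(1,2)] by blast
    let ?L = "\<lambda>i. outer_approx X M (fst i)" and ?E = "\<lambda>i. inner_approx N (snd i)"
    let ?D = "\<lambda>n. {g \<in> continuous_maps X Y. \<forall>i \<in> I. g \<in> maps_into X Y (?L i n) (?E i n)}"
    have L: "shrinks_to X (?L i) (fst i)" if "i \<in> I" for i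
      using shrinks_to_outer_approx[OF M] I(2)[OF that] by blast
    have "\<exists>G. openin Y G \<and> f ` fst i \<subseteq> G \<and>
        (\<forall>\<C>. compactin ?T \<C> \<and> \<C> \<subseteq> maps_into X Y (fst i) G \<longrightarrow>
          (\<exists>n. \<C> \<subseteq> maps_into X Y (?L i n) (?E i n)))" if i: "i \<in> I" for i
    proof -
      have K: "compactin X (fst i)" using I(2)[OF i] by blast
      have "\<exists>W. openin Y W \<and> y \<in> W \<and> (\<forall>S. compactin Y S \<and> S \<subseteq> W \<longrightarrow> (\<exists>n. S \<subseteq> ?E i n))"
        if y: "y \<in> f ` fst i" for y
      proof -
        obtain x where x: "x \<in> fst i" "y = f x" using y by blast
        have "x \<in> topspace X" using x(1) compactin_subset_topspace[OF K] by blast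
        moreover have "openin Y (snd i)" "f x \<in> snd i"
          using I(2)[OF i] x(1) unfolding maps_into_def by blast+
        ultimately show ?thesis unfolding x(2) by (rule N)
      qed
      then show ?thesis
        using neighborhood_absorbing_compact_sets_of_maps[OF X reg fc K L[OF i] incseq_inner_approx]
        by (metis (no_types, lifting))
    qed
    then obtain G where "\<And>i. i \<in> I \<Longrightarrow> openin Y (G i) \<and> f ` fst i \<subseteq> G i \<and>
        (\<forall>\<C>. compactin ?T \<C> \<and> \<C> \<subseteq> maps_into X Y (fst i) (G i) \<longrightarrow>
          (\<exists>n. \<C> \<subseteq> maps_into X Y (?L i n) (?E i n)))"
      by metis
    then have G: "\<And>i. i \<in> I \<Longrightarrow> openin Y (G i)" "\<And>i. i \<in> I \<Longrightarrow> f ` fst i \<subseteq> G i"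
      "\<And>i \<C>. i \<in> I \<Longrightarrow> compactin ?T \<C> \<Longrightarrow> \<C> \<subseteq> maps_into X Y (fst i) (G i) \<Longrightarrow>
          \<exists>n. \<C> \<subseteq> maps_into X Y (?L i n) (?E i n)"
      by blast+
    define U where "U = (\<Inter>i\<in>I. maps_into X Y (fst i) (G i)) \<inter> topspace ?T"
    have "openin ?T U"
      unfolding U_def by (intro openin_INT openin_maps_into) (use I G in auto)
    moreover have fU: "f \<in> U" using G(2) f unfolding U_def maps_into_def by simp
    ultimately have nbU: "neighborhood_in ?T f U"
      using openin_subset unfolding neighborhood_in_def by blast
    have absorb: "\<exists>\<F>. finite \<F> \<and> \<F> \<subseteq> mapping_family X Y M N \<and> f \<in> \<Inter>\<F> \<and> \<C> \<subseteq> \<Union>\<F> \<and> \<Union>\<F> \<subseteq> V"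
      if \<C>: "compactin ?T \<C>" "\<C> \<subseteq> U" for \<C>
    proof -
      \<comment> \<open>Adjoining \<open>f\<close> to \<open>\<C>\<close> ensures that the chosen
        set also contains \<open>f\<close>.\<close>
      have "compactin ?T ({f} \<union> \<C>)"
        using \<C>(1) f by (intro compactin_Un) auto
      moreover have "{f} \<union> \<C> \<subseteq> maps_into X Y (fst i) (G i)" if "i \<in> I" for i
        using fU \<C>(2) that unfolding U_def by blast
      ultimately have "\<forall>i\<in>I. \<exists>n. {f} \<union> \<C> \<subseteq> maps_into X Y (?L i n) (?E i n)"
        using G(3) by blast
      then obtain n where n: "\<And>i. i \<in> I \<Longrightarrow> {f} \<union> \<C> \<subseteq> maps_into X Y (?L i (n i)) (?E i (n i))"
        by metis
      define k where "k = Max (insert 0 (n ` I))"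
      have "maps_into X Y (?L i (n i)) (?E i (n i)) \<subseteq> maps_into X Y (?L i k) (?E i k)" if "i \<in> I" for i
      proof -
        have "n i \<le> k" using that I(1) unfolding k_def by simp
        then show ?thesis
          using shrinks_toD(1)[OF L[OF that]] incseq_inner_approx[of N "snd i"]
          by (intro maps_into_mono) (auto simp: incseq_def)
      qed
      then have "{f} \<union> \<C> \<subseteq> ?D k" using n \<C>(2) f unfolding U_def by fastforce
      moreover have "?D k \<in> mapping_family X Y M N" by (rule approx_in_mapping_family[OF I(1)])
      moreover have "?D k \<subseteq> V"
      proof -
        have "maps_into X Y (?L i k) (?E i k) \<subseteq> maps_into X Y (fst i) (snd i)" if "i \<in> I" for i
          using shrinks_toD(2)[OF L[OF that]] inner_approx_subset by (intro maps_into_mono)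
        then show ?thesis using I(3) W(3) by blast
      qed
      ultimately show ?thesis by (intro exI[of _ "{?D k}"]) simp
    qed
    show ?thesis by (intro exI[of _ U] conjI[OF nbU] allI impI absorb) simp_all
  qed
  have "ck_network_at ?T f (mapping_family X Y M N)"
    unfolding ck_network_at_def topspace_compact_open_topology
    by (intro conjI mapping_family_subset allI impI main)
  then show ?thesis using countable_mapping_family by blast
qed

theorem theorem1p7:
  fixes X :: "'a topology" and Y :: "'b topology"
  assumes "aleph0_space X"
  shows "(frakP_space Y \<longrightarrow> strong_Pytkeev_property (compact_open_topology X Y)) \<and>
         (strict_aleph_space Y \<longrightarrow>
            (\<forall>f \<in> continuous_maps X Y.
               \<exists>\<N>. countable \<N> \<and> ck_network_at (compact_open_topology X Y) f \<N>))"
proof -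
  obtain \<K> where "countable \<K>" "k_network X \<K>"
    using assms unfolding aleph0_space_def by blast
  then obtain M :: "nat \<Rightarrow> 'a set" where
    M: "\<And>K U. compactin X K \<Longrightarrow> openin X U \<Longrightarrow> K \<subseteq> U \<Longrightarrow> \<exists>n. K \<subseteq> M n \<and> M n \<subseteq> U"
    using k_network_enumeration by blast
  have "Hausdorff_space X" using assms unfolding aleph0_space_def by blast
  then show ?thesis
    using strong_Pytkeev_property_compact_open_topology[OF M]
      countable_ck_network_at_compact_open_topology[OF M] by blast
qed

end
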